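(* For any admissible $\psi\in\mathcal S$, the synthesis operator $T_\psi$ is defined on $\dot f^s_{\vec p,q}$, i.e. $\dot f^s_{\vec p,q}\subset D(T_\psi)$, for any $s\in\mathbb{R}$, any $\vec p=(p_1,\dots,p_n)$ with $p_1,\dots,p_n\in\,]0,\infty[$, and any $0<q\le\infty$.
   Context: Fourier transform: $\hat f(\xi)=\int e^{-i x\cdot\xi}f(x)\,dx$ on $\mathbb{R}^n$. Pairings are anti-linear in the second slot: $\langle f,\phi\rangle=\int f\overline{\phi}\,dx$. $\mathcal S$ denotes the Schwartz functions on $\mathbb{R}^n$. Admissibility: fix constants $0<K_0<K_1<1<K^1<K^0$ with $2K_1<K^1$ and $K^0<\pi$. A function $\psi\in\mathcal S$ is admissible if $\operatorname{supp}\hat\psi\subset\{\xi: K_0\le|\xi|\le K^0\}$ and, for some $c>0$, $|\hat\psi(\xi)|\ge c$ for $K_1\le|\xi|\le K^1$. Dyadic cubes: for $\nu\in\mathbb{Z}$, $k\in\mathbb{Z}^n$, $Q_{\nu k}=\{x\in\mathbb{R}^n: k_i\le 2^\nu x_i<k_i+1,\ i=1,\dots,n\}$; $\mathcal Q$ is the set of all of these. For $Q=Q_{\nu k}$: $\ell(Q)=2^{-\nu}$, $|Q|=2^{-\nu n}$ and $\psi_Q(x)=2^{n\nu/2}\psi(2^\nu x-k)$. $\mathcal Z=\{\phi\in\mathcal S:\int x^\alpha\phi(x)\,dx=0\ \text{for all multiindices }\alpha\}$. A "sequence" is a family $a=\{a_Q\}_{Q\in\mathcal Q}$ of complex numbers.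 $D(T_\psi)$ is the set of sequences $a$ with $\sum_{Q\in\mathcal Q}|a_Q||\langle\psi_Q,\phi\rangle|<\infty$ for every $\phi\in\mathcal Z$; for such $a$, $T_\psi a$ is the element of the dual $\mathcal Z'$ (which equals $\mathcal S'$ modulo polynomials) given by $\langle T_\psi a,\phi\rangle=\sum_{Q\in\mathcal Q}a_Q\langle\psi_Q,\phi\rangle$, $\phi\in\mathcal Z$. Mixed (quasi-)norm: $\|f\|_{\vec p}=\Big(\int_{\mathbb R}\cdots\Big(\int_{\mathbb R}\Big(\int_{\mathbb R}|f(x_1,\dots,x_n)|^{p_1}dx_1\Big)^{p_2/p_1}dx_2\Big)^{p_3/p_2}\cdots dx_n\Big)^{1/p_n}$. $\dot f^s_{\vec p,q}$ is the set of sequences $a$ with $\|a\|_{\dot f^s_{\vec p,q}}=\Big\|\Big(\sum_{\nu\in\mathbb Z}\Big(\sum_{\ell(Q)=2^{-\nu}}|Q|^{-s/n-1/2}|a_Q|\mathbf 1_Q\Big)^q\Big)^{1/q}\Big\|_{\vec p}<\infty$ ($\sup_\nu$ in place of the $\ell_q$-norm for $q=\infty$), $\mathbf 1_Q$ being the characteristic function of $Q$. *)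

theory Defs
  imports "HOL-Analysis.Analysis"
begin

text \<open>\<open>\<real>\<^sup>n\<close> is \<^typ>\<open>real ^ 'n\<close>. Where the order of the coordinates matters (in the mixed norm), the finite
  index type carries a linear order, and \<open>x\<^sub>1, \<dots>, x\<^sub>n\<close> are the coordinates in increasing order
  of their indices.\<close>

subsection \<open>Schwartz functions, Fourier transform, admissibility\<close>

definition partial :: "'n::finite \<Rightarrow> (real ^ 'n \<Rightarrow> complex) \<Rightarrow> real ^ 'n \<Rightarrow> complex" where
  "partial i f x = frechet_derivative f (at x) (axis i 1)"

text \<open>Multiindices for derivatives are lists of coordinate directions,
  \<open>[i, j, \<dots>]\<close> standing for \<open>\<partial>\<^sub>i \<partial>\<^sub>j \<dots>\<close>.\<close>

definition partials :: "'n::finite list \<Rightarrow> (real ^ 'n \<Rightarrow> complex) \<Rightarrow> real ^ 'n \<Rightarrow> complex" where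
  "partials is f = foldr partial is f"

definition monomial :: "('n::finite \<Rightarrow> nat) \<Rightarrow> real ^ 'n \<Rightarrow> real" where
  "monomial \<alpha> x = (\<Prod>i\<in>UNIV. (x $ i) ^ \<alpha> i)"

text \<open>Differentiability of all iterated partial derivatives is the same as \<open>C\<^sup>\<infinity>\<close>.\<close>

definition schwartz :: "(real ^ 'n::finite \<Rightarrow> complex) set" where
  "schwartz = {f. (\<forall>is. partials is f differentiable_on UNIV) \<and>
     (\<forall>\<alpha> is. bounded (range (\<lambda>x. of_real (monomial \<alpha> x) * partials is f x)))}"

definition fourier :: "(real ^ 'n::finite \<Rightarrow> complex) \<Rightarrow> real ^ 'n \<Rightarrow> complex" where
  "fourier f \<xi> = (LINT x|lborel. exp (- \<i> * of_real (x \<bullet> \<xi>)) * f x)"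

text \<open>The arguments are, in this order, \<open>K\<^sub>0, K\<^sub>1, K\<^sup>1, K\<^sup>0\<close>.\<close>

definition admissible ::
    "real \<Rightarrow> real \<Rightarrow> real \<Rightarrow> real \<Rightarrow> (real ^ 'n::finite \<Rightarrow> complex) \<Rightarrow> bool" where
  "admissible K0 K1 K1' K0' \<psi> \<longleftrightarrow> \<psi> \<in> schwartz \<and>
     closure {\<xi>. fourier \<psi> \<xi> \<noteq> 0} \<subseteq> {\<xi>. K0 \<le> norm \<xi> \<and> norm \<xi> \<le> K0'} \<and>
     (\<exists>c>0. \<forall>\<xi>. K1 \<le> norm \<xi> \<and> norm \<xi> \<le> K1' \<longrightarrow> norm (fourier \<psi> \<xi>) \<ge> c)"

subsection \<open>Dyadic cubes and the synthesis operator\<close>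

definition dyadic_cube :: "int \<Rightarrow> int ^ 'n::finite \<Rightarrow> (real ^ 'n) set" where
  "dyadic_cube \<nu> k =
     {x. \<forall>i. of_int (k $ i) \<le> 2 powi \<nu> * x $ i \<and> 2 powi \<nu> * x $ i < of_int (k $ i) + 1}"

lemma dyadic_cube_inject:
  "dyadic_cube \<nu> k = dyadic_cube \<mu> (l :: int ^ 'n::finite) \<longleftrightarrow> \<nu> = \<mu> \<and> k = l"
proof
  assume eq: "dyadic_cube \<nu> k = dyadic_cube \<mu> l"
  have image: "(\<lambda>x. x $ i) ` dyadic_cube \<nu> k =
      {of_int (k $ i) / 2 powi \<nu>..<(of_int (k $ i) + 1) / 2 powi \<nu>}"
    for \<nu> and k :: "int ^ 'n" and i
  proof (intro subset_antisym subsetI)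
    fix t :: real assume t: "t \<in> {of_int (k $ i) / 2 powi \<nu>..<(of_int (k $ i) + 1) / 2 powi \<nu>}"
    define x :: "real ^ 'n" where "x = (\<chi> j. if j = i then t else of_int (k $ j) / 2 powi \<nu>)"
    have "x \<in> dyadic_cube \<nu> k" "x $ i = t"
      using t by (auto simp: dyadic_cube_def x_def pos_divide_le_eq pos_less_divide_eq mult.commute)
    then show "t \<in> (\<lambda>x. x $ i) ` dyadic_cube \<nu> k" by blast
  qed (auto simp: dyadic_cube_def pos_divide_le_eq pos_less_divide_eq mult.commute)
  have ends: "of_int (k $ i) / 2 powi \<nu> = (of_int (l $ i) / 2 powi \<mu> :: real) \<and>
      (of_int (k $ i) + 1) / 2 powi \<nu> = ((of_int (l $ i) + 1) / 2 powi \<mu> :: real)" for i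
  proof -
    have "of_int (k $ i) / 2 powi \<nu> < ((of_int (k $ i) + 1) / 2 powi \<nu> :: real)"
      "of_int (l $ i) / 2 powi \<mu> < ((of_int (l $ i) + 1) / 2 powi \<mu> :: real)"
      by (simp_all add: divide_strict_right_mono)
    then show ?thesis
      using image[of i \<nu> k] image[of i \<mu> l] eq by (simp add: atLeastLessThan_eq_iff)
  qed
  then have "1 / 2 powi \<nu> = (1 / 2 powi \<mu> :: real)"
    by (metis add_diff_cancel_left' diff_divide_distrib)
  then have p: "2 powi \<nu> = (2 powi \<mu> :: real)" by simp
  then have "\<nu> = \<mu>"
    by (metis linorder_neq_iff one_less_numeral_iff power_int_strict_increasing semiring_norm(76))
  moreover have "k = l"
    using ends p by (simp add: vec_eq_iff)
  ultimately show "\<nu> = \<mu> \<and> k = l" ..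
qed simp

text \<open>By \<open>dyadic_cube_inject\<close>, families indexed by the dyadic cubes are the same as families indexed by the pairs
  \<open>(\<nu>, k)\<close>.\<close>

type_synonym 'n cube_seq = "int \<times> (int ^ 'n) \<Rightarrow> complex"

definition cube_volume :: "'n::finite itself \<Rightarrow> int \<Rightarrow> real" where
  "cube_volume _ \<nu> = 2 powr (- of_int \<nu> * real CARD('n))"

definition dilate :: "(real ^ 'n::finite \<Rightarrow> complex) \<Rightarrow> int \<times> (int ^ 'n) \<Rightarrow> real ^ 'n \<Rightarrow> complex" where
  "dilate \<psi> = (\<lambda>(\<nu>, k) x. of_real (2 powr (real CARD('n) * of_int \<nu> / 2)) *
     \<psi> (2 powi \<nu> *\<^sub>R x - (\<chi> i. of_int (k $ i))))"

definition pairing :: "(real ^ 'n::finite \<Rightarrow> complex) \<Rightarrow> (real ^ 'n \<Rightarrow> complex) \<Rightarrow> complex" where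
  "pairing f \<phi> = (LINT x|lborel. f x * cnj (\<phi> x))"

definition schwartz0 :: "(real ^ 'n::finite \<Rightarrow> complex) set" where
  "schwartz0 = {\<phi> \<in> schwartz. \<forall>\<alpha>. (LINT x|lborel. of_real (monomial \<alpha> x) * \<phi> x) = 0}"

definition synthesis_domain :: "(real ^ 'n::finite \<Rightarrow> complex) \<Rightarrow> 'n cube_seq set" where
  "synthesis_domain \<psi> = {a. \<forall>\<phi>\<in>schwartz0.
     (\<lambda>Q. norm (a Q) * norm (pairing (dilate \<psi> Q) \<phi>)) summable_on UNIV}"

text \<open>Meaningful for \<open>a\<close> in the synthesis domain and \<open>\<phi>\<close> in \<^const>\<open>schwartz0\<close>.\<close>

definition synthesis ::
    "(real ^ 'n::finite \<Rightarrow> complex) \<Rightarrow> 'n cube_seq \<Rightarrow> (real ^ 'n \<Rightarrow> complex) \<Rightarrow> complex" where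
  "synthesis \<psi> a \<phi> = (\<Sum>\<^sub>\<infinity>Q. a Q * pairing (dilate \<psi> Q) \<phi>)"

subsection \<open>Mixed norms and the sequence space\<close>

text \<open>Powers of extended nonnegative reals, used for exponents \<open>r > 0\<close> only.\<close>

definition ennpow :: "ennreal \<Rightarrow> real \<Rightarrow> ennreal" where
  "ennpow x r = (if x = \<infinity> then \<infinity> else ennreal (enn2real x powr r))"

text \<open>The head of the list is the coordinate of the innermost integral. With
  \<open>F = (\<integral>|f|\<^bsup>p\<^sub>1\<^esup> dx\<^sub>1)\<^bsup>1/p\<^sub>1\<^esup>\<close>, the integrand \<open>(\<integral>|f|\<^bsup>p\<^sub>1\<^esup> dx\<^sub>1)\<^bsup>p\<^sub>2/p\<^sub>1\<^esup>\<close> of the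
  second integral is \<open>F\<^bsup>p\<^sub>2\<^esup>\<close>, and so on.\<close>

primrec iterated_norm ::
    "real ^ 'n::finite \<Rightarrow> 'n list \<Rightarrow> (real ^ 'n \<Rightarrow> ennreal) \<Rightarrow> real ^ 'n \<Rightarrow> ennreal" where
  "iterated_norm p [] f = f"
| "iterated_norm p (i # is) f = iterated_norm p is
     (\<lambda>x. ennpow (\<integral>\<^sup>+t. ennpow (f (\<chi> j. if j = i then t else x $ j)) (p $ i) \<partial>lborel) (1 / p $ i))"

text \<open>After all coordinates have been integrated out, the function is constant, so the point of
  evaluation is irrelevant.\<close>

definition mixed_norm ::
    "real ^ 'n::{finite,linorder} \<Rightarrow> (real ^ 'n::{finite,linorder} \<Rightarrow> ennreal) \<Rightarrow> ennreal" where
  "mixed_norm p f = iterated_norm p (sorted_list_of_set UNIV) f 0"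

definition lq_norm :: "ennreal \<Rightarrow> (int \<Rightarrow> ennreal) \<Rightarrow> ennreal" where
  "lq_norm q c = (if q = \<infinity> then (SUP \<nu>. c \<nu>)
     else ennpow (\<Sum>\<^sub>\<infinity>\<nu>. ennpow (c \<nu>) (enn2real q)) (1 / enn2real q))"

definition fdot_norm ::
    "real \<Rightarrow> real ^ 'n::{finite,linorder} \<Rightarrow> ennreal \<Rightarrow> 'n cube_seq \<Rightarrow> ennreal" where
  "fdot_norm s p q a = mixed_norm p (\<lambda>x. lq_norm q (\<lambda>\<nu>. \<Sum>\<^sub>\<infinity>k.
     ennreal (cube_volume TYPE('n) \<nu> powr (- s / real CARD('n) - 1/2) * norm (a (\<nu>, k))
       * indicator (dyadic_cube \<nu> k) x)))"

definition fdot_space ::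
    "real \<Rightarrow> real ^ 'n::{finite,linorder} \<Rightarrow> ennreal \<Rightarrow> 'n cube_seq set" where
  "fdot_space s p q = {a. fdot_norm s p q a < \<infinity>}"

end

theory Submission
  imports Defs
begin

text \<open>A single cube already bounds the norm of \<open>a\<close> from below, so \<open>|a\<^sub>Q| \<le> A 2\<^bsup>c\<nu>\<^esup>\<close> for
  \<open>\<ell>(Q) = 2\<^bsup>-\<nu>\<^esup>\<close>, with some real \<open>c\<close>. All moments of \<open>\<psi>\<close> vanish because its Fourier transform
  vanishes near the origin; all moments of \<open>\<phi>\<close> vanish by hypothesis. Taylor expansion of the function living at the
  coarser scale, tested against the other one, therefore gives
  \<open>|\<langle>\<psi>\<^sub>Q, \<phi>\<rangle>| \<le> C 2\<^bsup>-M|\<nu>|\<^esup> (1 + |k|)\<^bsup>-N\<^esup>\<close> for all \<open>M\<close> and \<open>N\<close>, and the sum over \<open>\<nu>\<close> and \<open>k\<close> converges.\<close>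

section \<open>Monomials indexed by lists of directions\<close>

text \<open>Lists match the indexing of \<open>partials\<close>: a Taylor term of order j becomes a
  sum over all ordered lists of length j with the single factor 1/j!, so no multinomial coefficients
  arise.\<close>

definition list_monomial :: "'n::finite list \<Rightarrow> real ^ 'n \<Rightarrow> real" where
  "list_monomial js x = prod_list (map (($) x) js)"

lemma list_monomial_simps [simp]:
  "list_monomial [] x = 1"
  "list_monomial (i # js) x = x $ i * list_monomial js x"
  by (simp_all add: list_monomial_def)

text \<open>Carries the moment conditions of \<open>schwartz0\<close>, stated with exponent
  functions, over to lists.\<close>

lemma list_monomial_eq_monomial:
  fixes js :: "'n::finite list"
  shows "list_monomial js = monomial (count_list js)"
proof (induction js)
  case (Cons i js)
  have "(\<Prod>j\<in>UNIV. x $ j ^ count_list (i # js) j) = x $ i * (\<Prod>j\<in>UNIV. x $ j ^ count_list js j)"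
    for x :: "real ^ 'n"
  proof -
    have "(\<Prod>j\<in>UNIV. x $ j ^ count_list (i # js) j)
        = (\<Prod>j\<in>UNIV. (if j = i then x $ j else 1) * x $ j ^ count_list js j)"
      by (intro prod.cong) auto
    then show ?thesis
      by (simp add: prod.distrib)
  qed
  then show ?case
    by (intro ext) (simp only: list_monomial_simps Cons.IH monomial_def)
qed (simp add: fun_eq_iff monomial_def)

lemma list_monomial_scale: "list_monomial js (c *\<^sub>R x) = c ^ length js * list_monomial js x"
  by (induction js) (simp_all add: mult_ac)

lemma abs_list_monomial_le: "\<bar>list_monomial js x\<bar> \<le> norm x ^ length js"
  by (induction js) (auto simp: abs_mult intro!: mult_mono component_le_norm_cart)

lemma continuous_on_list_monomial [continuous_intros]: "continuous_on A (list_monomial js)"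
  by (induction js) (auto intro!: continuous_intros simp: list_monomial_simps[abs_def])

lemma borel_measurable_list_monomial [measurable]: "list_monomial js \<in> borel_measurable borel"
  by (intro borel_measurable_continuous_onI continuous_on_list_monomial)

lemma finite_lists_length: "finite {js :: 'n::finite list. length js = m}"
  using finite_lists_length_eq[of "UNIV :: 'n set" m] by simp

text \<open>Needed for Taylor expansion: each differentiation along a line prepends one direction to
  the list, so the derivative of the j-th term is recognised as a sum over lists of length j +
  1.\<close>

lemma sum_lists_Suc:
  "(\<Sum>js | length js = Suc m. F js) = (\<Sum>js | length js = m. \<Sum>i\<in>(UNIV :: 'n::finite set). F (i # js))"
proof -
  have "{js :: 'n list. length js = Suc m} = (\<lambda>(js, i). i # js) ` ({js. length js = m} \<times> UNIV)"
    by (force simp: length_Suc_conv image_iff)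
  moreover have "inj_on (\<lambda>(js, i). i # js) ({js. length js = m} \<times> (UNIV :: 'n set))"
    by (auto simp: inj_on_def)
  ultimately show ?thesis
    by (simp add: sum.reindex sum.cartesian_product case_prod_unfold)
qed

section \<open>Decay and integrability of Schwartz functions\<close>

text \<open>The norm is at most n times the largest coordinate modulus. The weight is thus
  controlled by 1 and the pure powers of the coordinates, which are monomials and so covered by the
  definition of \<open>schwartz\<close>.\<close>

lemma one_plus_norm_power_le:
  fixes x :: "real ^ 'n::finite"
  shows "(1 + norm x) ^ N \<le> (1 + real CARD('n)) ^ N * (1 + (\<Sum>i\<in>UNIV. \<bar>x $ i\<bar> ^ N))"
proof -
  define M where "M = Max (range (\<lambda>i. \<bar>x $ i\<bar>))"
  have "M \<in> range (\<lambda>i. \<bar>x $ i\<bar>)"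
    unfolding M_def by (rule Max_in) auto
  then obtain i where i: "M = \<bar>x $ i\<bar>"
    by auto
  have M: "\<bar>x $ j\<bar> \<le> M" for j
    unfolding M_def by (rule Max_ge) auto
  have "norm x \<le> (\<Sum>j\<in>UNIV. \<bar>x $ j\<bar>)"
    by (rule norm_le_l1_cart)
  also have "\<dots> \<le> real CARD('n) * M"
    using sum_bounded_above[of UNIV "\<lambda>j. \<bar>x $ j\<bar>" M] M by simp
  also have "\<dots> \<le> real CARD('n) * max 1 M"
    by (intro mult_left_mono) auto
  finally have "1 + norm x \<le> (1 + real CARD('n)) * max 1 M"
    by (simp add: distrib_right)
  then have "(1 + norm x) ^ N \<le> ((1 + real CARD('n)) * max 1 M) ^ N"
    by (intro power_mono) auto
  also have "\<dots> = (1 + real CARD('n)) ^ N * max 1 M ^ N"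
    by (rule power_mult_distrib)
  also have "max 1 M ^ N \<le> 1 + \<bar>x $ i\<bar> ^ N"
    using i by (auto simp: max_def)
  also have "\<bar>x $ i\<bar> ^ N \<le> (\<Sum>j\<in>UNIV. \<bar>x $ j\<bar> ^ N)"
    by (rule member_le_sum) auto
  finally show ?thesis
    by (simp add: mult_left_mono)
qed

lemma schwartz_decay:
  fixes f :: "real ^ 'n::finite \<Rightarrow> complex"
  assumes "f \<in> schwartz"
  obtains C where "\<And>x. (1 + norm x) ^ N * norm (partials js f x) \<le> C"
proof -
  have bdd: "\<exists>B. \<forall>x. \<bar>monomial \<alpha> x\<bar> * norm (partials js f x) \<le> B" for \<alpha>
    using assms unfolding schwartz_def bounded_iff by (auto simp: norm_mult)
  have mono: "monomial (\<lambda>j. if j = i then N else 0) x = x $ i ^ N" for i and x :: "real ^ 'n"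
  proof -
    have "monomial (\<lambda>j. if j = i then N else 0) x = (\<Prod>j\<in>UNIV. if j = i then x $ j ^ N else 1)"
      unfolding monomial_def by (intro prod.cong) auto
    then show ?thesis
      by simp
  qed
  obtain B0 where B0: "\<And>x. norm (partials js f x) \<le> B0"
    using bdd[of "\<lambda>_. 0"] by (auto simp: monomial_def)
  have "\<forall>i. \<exists>B. \<forall>x. \<bar>x $ i\<bar> ^ N * norm (partials js f x) \<le> B"
    using bdd mono by (metis power_abs)
  then obtain B where B: "\<And>i x. \<bar>x $ i\<bar> ^ N * norm (partials js f x) \<le> B i"
    by metis
  show ?thesis
  proof
    fix x
    have "(1 + norm x) ^ N * norm (partials js f x)
        \<le> (1 + real CARD('n)) ^ N * (1 + (\<Sum>i\<in>UNIV. \<bar>x $ i\<bar> ^ N)) * norm (partials js f x)"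
      by (intro mult_right_mono one_plus_norm_power_le) auto
    also have "\<dots> = (1 + real CARD('n)) ^ N *
        (norm (partials js f x) + (\<Sum>i\<in>UNIV. \<bar>x $ i\<bar> ^ N * norm (partials js f x)))"
      by (simp add: algebra_simps sum_distrib_left sum_distrib_right)
    also have "\<dots> \<le> (1 + real CARD('n)) ^ N * (B0 + (\<Sum>i\<in>UNIV. B i))"
      by (intro mult_left_mono add_mono sum_mono B0 B) auto
    finally show "(1 + norm x) ^ N * norm (partials js f x)
        \<le> (1 + real CARD('n)) ^ N * (B0 + (\<Sum>i\<in>UNIV. B i))" .
  qed
qed

lemma schwartz_decay_uniform:
  fixes f :: "real ^ 'n::finite \<Rightarrow> complex"
  assumes "f \<in> schwartz"
  obtains C where "C > 0" "\<And>js x. length js = m \<Longrightarrow> norm (partials js f x) \<le> C / (1 + norm x) ^ N"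
proof -
  have "\<forall>js. \<exists>C. \<forall>x. (1 + norm x) ^ N * norm (partials js f x) \<le> C"
    using schwartz_decay[OF assms] by metis
  then obtain C where C: "\<And>js x. (1 + norm x) ^ N * norm (partials js f x) \<le> C js"
    by metis
  \<comment> \<open>Only finitely many lists have length m, so their constants can be added; the
    leading 1 makes the result strictly positive.\<close>
  define D where "D = 1 + (\<Sum>js | length js = m. \<bar>C js\<bar>)"
  show ?thesis
  proof
    show "D > 0"
      unfolding D_def by (intro add_pos_nonneg sum_nonneg) auto
  next
    fix js :: "'n list" and x assume "length js = m"
    then have "\<bar>C js\<bar> \<le> (\<Sum>js | length js = m. \<bar>C js\<bar>)"
      by (intro member_le_sum) (auto simp: finite_lists_length)
    with C[of x js] have "(1 + norm x) ^ N * norm (partials js f x) \<le> D"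
      by (simp add: D_def)
    moreover have "0 < (1 + norm x) ^ N"
      by (simp add: add_pos_nonneg)
    ultimately show "norm (partials js f x) \<le> D / (1 + norm x) ^ N"
      by (simp add: pos_le_divide_eq mult.commute)
  qed
qed

lemma schwartz_partials_differentiable: "f \<in> schwartz \<Longrightarrow> partials js f differentiable (at x)"
  by (auto simp: schwartz_def differentiable_on_def)

lemma partials_simps [simp]:
  "partials [] f = f"
  "partials (i # js) f = partial i (partials js f)"
  by (simp_all add: partials_def)

lemma schwartz_continuous_on: "f \<in> schwartz \<Longrightarrow> continuous_on A f"
  using schwartz_partials_differentiable[of f "[]"]
  by (auto intro: differentiable_imp_continuous_within continuous_at_imp_continuous_on)

lemma schwartz_borel_measurable: "f \<in> schwartz \<Longrightarrow> f \<in> borel_measurable borel"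
  by (intro borel_measurable_continuous_onI schwartz_continuous_on)

text \<open>On the half-line the antiderivative is arctan; reflection handles the other half. Both
  indicators contain 0, hence an inequality rather than an equation in the splitting.\<close>

lemma nn_integral_inverse_one_plus_square_finite:
  "(\<integral>\<^sup>+x. ennreal (inverse (1 + x\<^sup>2)) \<partial>lborel) < \<infinity>"
proof -
  let ?g = "\<lambda>x::real. ennreal (inverse (1 + x\<^sup>2))"
  have half: "(\<integral>\<^sup>+x. ?g x * indicator {0..} x \<partial>lborel) = ennreal (pi / 2 - arctan 0)"
    by (rule nn_integral_FTC_atLeast)
      (auto intro!: derivative_eq_intros tendsto_arctan_at_top simp: add_nonneg_nonneg)
  have "(\<integral>\<^sup>+x. ?g x \<partial>lborel)
      \<le> (\<integral>\<^sup>+x. ?g x * indicator {0..} x + ?g (-x) * indicator {0..} (-x) \<partial>lborel)"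
    by (intro nn_integral_mono) (auto simp: indicator_def)
  also have "\<dots> = (\<integral>\<^sup>+x. ?g x * indicator {0..} x \<partial>lborel)
      + (\<integral>\<^sup>+x. ?g (-x) * indicator {0..} (-x) \<partial>lborel)"
    by (intro nn_integral_add) auto
  also have "(\<integral>\<^sup>+x. ?g (-x) * indicator {0..} (-x) \<partial>lborel) = (\<integral>\<^sup>+x. ?g x * indicator {0..} x \<partial>lborel)"
    by (subst (2) nn_integral_real_affine[where c = "-1" and t = 0]) auto
  finally show ?thesis
    unfolding half by (simp add: le_less_trans)
qed

text \<open>The exponent 2n provides one factor \<open>(1 + norm x)\<^sup>2\<close> per coordinate,
  each at least \<open>1 + (x \<bullet> b)\<^sup>2\<close>. The integrand is therefore dominated by
  a product of one-dimensional integrable functions.\<close>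

lemma integrable_inverse_one_plus_norm_power:
  "integrable lborel (\<lambda>x :: 'a::euclidean_space. inverse ((1 + norm x) ^ (2 * DIM('a))))"
proof (rule integrableI_nonneg)
  have le: "inverse ((1 + norm x) ^ (2 * DIM('a))) \<le> (\<Prod>b\<in>Basis. inverse (1 + (x \<bullet> b)\<^sup>2))" for x :: 'a
  proof -
    have "1 + (x \<bullet> b)\<^sup>2 \<le> (1 + norm x)\<^sup>2" if "b \<in> Basis" for b
    proof -
      have "(x \<bullet> b)\<^sup>2 \<le> (norm x)\<^sup>2"
        using Basis_le_norm[OF that, of x] by (metis abs_ge_zero power2_abs power_mono)
      then show ?thesis
        by (simp add: power2_sum add_increasing2)
    qed
    then have "(\<Prod>b\<in>Basis. 1 + (x \<bullet> b)\<^sup>2) \<le> (\<Prod>b\<in>(Basis :: 'a set). (1 + norm x)\<^sup>2)"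
      by (intro prod_mono) auto
    also have "\<dots> = (1 + norm x) ^ (2 * DIM('a))"
      by (simp add: power_mult)
    finally have "inverse ((1 + norm x) ^ (2 * DIM('a))) \<le> inverse (\<Prod>b\<in>Basis. 1 + (x \<bullet> b)\<^sup>2)"
      by (intro le_imp_inverse_le prod_pos) (auto intro: add_pos_nonneg)
    then show ?thesis
      by (simp add: prod_inversef[symmetric] comp_def)
  qed
  have "(\<integral>\<^sup>+(x::'a). ennreal (inverse ((1 + norm x) ^ (2 * DIM('a)))) \<partial>lborel)
      \<le> (\<integral>\<^sup>+(x::'a). (\<Prod>b\<in>Basis. ennreal (inverse (1 + (x \<bullet> b)\<^sup>2))) \<partial>lborel)"
    using le by (intro nn_integral_mono) (simp add: prod_ennreal ennreal_leI)
  also have "\<dots> = (\<Prod>b\<in>(Basis :: 'a set). \<integral>\<^sup>+x. ennreal (inverse (1 + x\<^sup>2)) \<partial>lborel)"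
    by (rule nn_integral_lborel_prod[where f = "\<lambda>_ x. ennreal (inverse (1 + x\<^sup>2))"]) auto
  also have "\<dots> < \<infinity>"
    using nn_integral_inverse_one_plus_square_finite by (simp add: power_less_top_ennreal)
  finally show "(\<integral>\<^sup>+(x::'a). ennreal (inverse ((1 + norm x) ^ (2 * DIM('a)))) \<partial>lborel) < \<infinity>" .
qed auto

lemma schwartz_weighted_integrable:
  fixes f :: "real ^ 'n::finite \<Rightarrow> complex"
  assumes f: "f \<in> schwartz"
  shows "integrable lborel (\<lambda>x. (1 + norm x) ^ N * norm (f x))"
proof -
  have [measurable]: "f \<in> borel_measurable borel"
    by (rule schwartz_borel_measurable[OF f])
  \<comment> \<open>The 2n powers beyond N leave an integrable majorant.\<close>
  obtain C where C: "\<And>x. (1 + norm x) ^ (N + 2 * CARD('n)) * norm (f x) \<le> C"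
    using schwartz_decay[OF f, where N = "N + 2 * CARD('n)" and js = "[]"] by auto
  have "integrable lborel (\<lambda>x :: real ^ 'n. C * inverse ((1 + norm x) ^ (2 * CARD('n))))"
    using integrable_inverse_one_plus_norm_power[where 'a = "real ^ 'n"] by simp
  then show ?thesis
  proof (rule Bochner_Integration.integrable_bound)
    have "(1 + norm x) ^ N * norm (f x) \<le> C * inverse ((1 + norm x) ^ (2 * CARD('n)))" for x
    proof -
      have "0 < (1 + norm x) ^ (2 * CARD('n))"
        by (simp add: add_pos_nonneg)
      then show ?thesis
        using C[of x] by (simp add: field_simps power_add)
    qed
    then show "AE x in lborel. norm ((1 + norm x) ^ N * norm (f x))
        \<le> norm (C * inverse ((1 + norm x) ^ (2 * CARD('n))))"
      by (intro AE_I2) (smt (verit) norm_ge_zero mult_nonneg_nonneg zero_le_power real_norm_def)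
  qed measurable
qed

lemma schwartz_mult_integrable:
  fixes f :: "real ^ 'n::finite \<Rightarrow> complex"
  assumes f: "f \<in> schwartz" and h [measurable]: "h \<in> borel_measurable borel"
    and bound: "\<And>x. norm (h x) \<le> K * (1 + norm x) ^ N"
  shows "integrable lborel (\<lambda>x. h x * f x)"
proof -
  have [measurable]: "f \<in> borel_measurable borel"
    by (rule schwartz_borel_measurable[OF f])
  have "integrable lborel (\<lambda>x. K * ((1 + norm x) ^ N * norm (f x)))"
    by (intro integrable_mult_right schwartz_weighted_integrable f)
  then show ?thesis
  proof (rule Bochner_Integration.integrable_bound)
    have "norm (h x * f x) \<le> K * ((1 + norm x) ^ N * norm (f x))" for x
      using mult_right_mono[OF bound, of "norm (f x)"] by (simp add: norm_mult mult_ac)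
    then show "AE x in lborel. norm (h x * f x) \<le> norm (K * ((1 + norm x) ^ N * norm (f x)))"
      by (intro AE_I2) (smt (verit) real_norm_def)
  qed measurable
qed

lemma abs_list_monomial_le': "\<bar>list_monomial js x\<bar> \<le> (1 + norm x) ^ length js"
  using abs_list_monomial_le[of js x] power_mono[of "norm x" "1 + norm x" "length js"] by simp

section \<open>Vanishing moments from a Fourier transform vanishing near the origin\<close>

lemma norm_iexp_minus_linear_le: "norm (exp (- (\<i> * of_real u)) - 1 + \<i> * of_real u) \<le> u\<^sup>2"
  using Taylor_exp[of "- (\<i> * of_real u)" 1] by (simp add: norm_mult power2_eq_square algebra_simps)

text \<open>Induction on the number of factors: the difference quotients of the identically vanishing
  function \<open>\<xi> \<mapsto> \<integral> e\<^bsup>-ix\<xi>\<^esup> x\<^bsup>\<alpha>\<^esup> \<psi>(x) dx\<close> converge to the integral with one more factor \<open>-i x\<^sub>i\<close>.\<close>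

lemma fourier_zero_imp_moment_zero:
  fixes \<psi> :: "real ^ 'n::finite \<Rightarrow> complex"
  assumes \<psi>: "\<psi> \<in> schwartz" and zero: "\<And>\<xi>. norm \<xi> < r \<Longrightarrow> fourier \<psi> \<xi> = 0"
    and "norm \<xi> < r"
  shows "(LINT x|lborel. exp (- \<i> * of_real (x \<bullet> \<xi>)) * (of_real (list_monomial js x) * \<psi> x)) = 0"
  using \<open>norm \<xi> < r\<close>
proof (induction js arbitrary: \<xi>)
  case Nil
  then show ?case
    using zero[of \<xi>] by (simp add: fourier_def)
next
  case (Cons i js)
  define E where "E = (\<lambda>\<xi> x :: real ^ 'n. exp (- \<i> * of_real (x \<bullet> \<xi>)))"
  define H where "H = (\<lambda>x. of_real (list_monomial js x) * \<psi> x)"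
  define I where "I = (LINT x|lborel. E \<xi> x * (of_real (list_monomial (i # js) x) * \<psi> x))"
  \<comment> \<open>Two powers beyond \<open>length js\<close>, because the second-order remainder
    contributes \<open>(x $ i)\<^sup>2\<close>.\<close>
  define N where "N = Suc (Suc (length js))"
  define K where "K = (LINT x|lborel. (1 + norm x) ^ N * norm (\<psi> x))"
  have norm_E: "norm (E \<xi> x) = 1" for \<xi> x
    by (simp add: E_def)
  have [measurable]: "E \<xi> \<in> borel_measurable borel" for \<xi>
    unfolding E_def by measurable
  have integrable: "integrable lborel (\<lambda>x. E \<xi> x * (of_real (list_monomial js x) * \<psi> x))" for \<xi> js
    unfolding mult.assoc[symmetric]
    by (rule schwartz_mult_integrable[OF \<psi>, where K = 1 and N = "length js"])
      (simp_all add: norm_mult norm_E abs_list_monomial_le')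
  have "K \<ge> 0"
    unfolding K_def by (intro Bochner_Integration.integral_nonneg) simp
  have bound: "norm I \<le> t * K" if t: "0 < t" "norm \<xi> + t < r" for t
  proof -
    define \<eta> where "\<eta> = \<xi> + t *\<^sub>R axis i 1"
    have "norm \<eta> < r"
      using norm_triangle_ineq[of \<xi> "t *\<^sub>R axis i 1"] t by (simp add: \<eta>_def)
    have \<eta>0: "(LINT x|lborel. E \<eta> x * H x) = 0" and \<xi>0: "(LINT x|lborel. E \<xi> x * H x) = 0"
      using Cons.IH[OF \<open>norm \<eta> < r\<close>] Cons.IH[OF Cons.prems] by (simp_all add: E_def H_def)
    \<comment> \<open>\<open>D\<close> is the increment of \<open>E \<xi> x * H x\<close> from \<xi>
      to \<eta> minus its linear part in t. The induction hypothesis makes the integrals of the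
      first two terms vanish, leaving \<open>\<i> * of_real t * I\<close>, whereas \<open>D\<close>
      is pointwise of second order in t.\<close>
    define D where "D = (\<lambda>x. E \<eta> x * H x - E \<xi> x * H x
      + \<i> * of_real t * (E \<xi> x * (of_real (list_monomial (i # js) x) * \<psi> x)))"
    have D_int: "integrable lborel D"
      unfolding D_def H_def by (intro Bochner_Integration.integrable_add Bochner_Integration.integrable_diff integrable_mult_right integrable)
    have "(LINT x|lborel. D x) = \<i> * of_real t * I"
      unfolding D_def
      using integrable[of \<eta> js] integrable[of \<xi> js] integrable[of \<xi> "i # js"] \<eta>0 \<xi>0
      by (simp add: H_def I_def integrable_mult_right del: list_monomial_simps)
    moreover have "norm (LINT x|lborel. D x) \<le> (LINT x|lborel. t\<^sup>2 * ((1 + norm x) ^ N * norm (\<psi> x)))"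
    proof (rule Bochner_Integration.integral_norm_bound_integral[OF D_int])
      show "integrable lborel (\<lambda>x. t\<^sup>2 * ((1 + norm x) ^ N * norm (\<psi> x)))"
        by (intro integrable_mult_right schwartz_weighted_integrable \<psi>)
      fix x :: "real ^ 'n"
      have "E \<eta> x = E \<xi> x * exp (- (\<i> * of_real (t * x $ i)))"
        by (simp add: E_def \<eta>_def inner_add_right inner_axis exp_add[symmetric] algebra_simps)
      then have "D x = E \<xi> x * (exp (- (\<i> * of_real (t * x $ i))) - 1 + \<i> * of_real (t * x $ i)) * H x"
        by (simp add: D_def H_def algebra_simps)
      then have "norm (D x) = norm (exp (- (\<i> * of_real (t * x $ i))) - 1 + \<i> * of_real (t * x $ i)) * norm (H x)"
        by (simp only: norm_mult norm_E)
      also have "\<dots> \<le> (t * x $ i)\<^sup>2 * norm (H x)"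
        by (intro mult_right_mono norm_iexp_minus_linear_le) simp
      also have "\<dots> = t\<^sup>2 * ((x $ i)\<^sup>2 * \<bar>list_monomial js x\<bar> * norm (\<psi> x))"
        by (simp add: H_def norm_mult power_mult_distrib)
      also have "\<dots> \<le> t\<^sup>2 * ((1 + norm x) ^ N * norm (\<psi> x))"
        using abs_list_monomial_le'[of "i # i # js" x]
        by (intro mult_left_mono mult_right_mono)
          (auto simp: N_def abs_mult power2_eq_square mult_ac abs_mult_self_eq)
      finally show "norm (D x) \<le> t\<^sup>2 * ((1 + norm x) ^ N * norm (\<psi> x))" .
    qed
    ultimately have "t * norm I \<le> t * (t * K)"
      using t by (simp add: norm_mult K_def power2_eq_square mult_ac)
    then show ?thesis
      using t by simp
  qed
  have "norm I \<le> 0"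
  proof (rule field_le_epsilon)
    fix e :: real assume "e > 0"
    \<comment> \<open>The first entry keeps \<eta> inside the ball where the induction hypothesis
      applies; the second makes \<open>t * K\<close> at most \<open>e\<close>, with
      \<open>K + 1\<close> as denominator because \<open>K\<close> may be 0.\<close>
    define t where "t = min ((r - norm \<xi>) / 2) (e / (K + 1))"
    have "0 < t"
      using Cons.prems \<open>e > 0\<close> \<open>K \<ge> 0\<close> by (simp add: t_def)
    have "t \<le> (r - norm \<xi>) / 2"
      unfolding t_def by (rule min.cobounded1)
    with Cons.prems have "norm \<xi> + t < r"
      by simp
    with \<open>0 < t\<close> have "norm I \<le> t * K"
      by (rule bound)
    also have "\<dots> \<le> e / (K + 1) * (K + 1)"
      using \<open>0 < t\<close> \<open>K \<ge> 0\<close> \<open>e > 0\<close> by (intro mult_mono) (auto simp: t_def)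
    finally show "norm I \<le> 0 + e"
      using \<open>K \<ge> 0\<close> by simp
  qed
  then show ?case
    by (simp add: I_def E_def)
qed

section \<open>Taylor expansion and pairings with functions of vanishing moments\<close>

lemma has_vector_derivative_along_line:
  fixes F :: "real ^ 'n::finite \<Rightarrow> complex"
  assumes "F differentiable at (y + t *\<^sub>R h)"
  shows "((\<lambda>t. F (y + t *\<^sub>R h)) has_vector_derivative
    (\<Sum>i\<in>UNIV. h $ i *\<^sub>R partial i F (y + t *\<^sub>R h))) (at t within S)"
proof -
  let ?D = "frechet_derivative F (at (y + t *\<^sub>R h))"
  have D: "(F has_derivative ?D) (at (y + t *\<^sub>R h))"
    using assms by (simp add: frechet_derivative_works)
  interpret D: bounded_linear ?D
    using D by (rule has_derivative_bounded_linear)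
  have "?D h = ?D (\<Sum>i\<in>UNIV. h $ i *\<^sub>R axis i 1)"
    using basis_expansion[of h] by (simp add: scalar_mult_eq_scaleR)
  also have "\<dots> = (\<Sum>i\<in>UNIV. h $ i *\<^sub>R partial i F (y + t *\<^sub>R h))"
    by (simp add: D.sum D.scaleR partial_def)
  finally have Dh: "?D h = (\<Sum>i\<in>UNIV. h $ i *\<^sub>R partial i F (y + t *\<^sub>R h))" .
  have "((\<lambda>t. y + t *\<^sub>R h) has_derivative (\<lambda>s. s *\<^sub>R h)) (at t within S)"
    by (auto intro!: derivative_eq_intros)
  from has_derivative_compose[OF this D] show ?thesis
    by (simp add: has_vector_derivative_def D.scaleR Dh)
qed

text \<open>Taylor's formula with integral remainder for t \<mapsto> f(y + t h) on [0,1], whose j-th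
  derivative is \<open>Df j\<close>. The kernel of the remainder is at most 1, and each list of
  length m contributes at most \<open>norm h ^ m * B\<close>.\<close>

lemma schwartz_taylor_bound:
  fixes f :: "real ^ 'n::finite \<Rightarrow> complex"
  assumes f: "f \<in> schwartz" and "m > 0"
    and B: "\<And>js t. length js = m \<Longrightarrow> 0 \<le> t \<Longrightarrow> t \<le> 1 \<Longrightarrow> norm (partials js f (y + t *\<^sub>R h)) \<le> B"
  shows "norm (f (y + h) - (\<Sum>j<m. (1 / fact j) *\<^sub>R
      (\<Sum>js | length js = j. list_monomial js h *\<^sub>R partials js f y)))
    \<le> real (card {js :: 'n list. length js = m}) * (norm h ^ m * B)"
proof -
  define Df where "Df = (\<lambda>j t. \<Sum>js | length js = j. list_monomial js h *\<^sub>R partials js f (y + t *\<^sub>R h))"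
  define P where "P = (\<Sum>j<m. (1 / fact j) *\<^sub>R Df j 0)"
  define M where "M = real (card {js :: 'n list. length js = m}) * (norm h ^ m * B)"
  have deriv: "(Df j has_vector_derivative Df (Suc j) t) (at t within {0..1})" for j t
  proof -
    have "(Df j has_vector_derivative (\<Sum>js | length js = j. list_monomial js h *\<^sub>R
        (\<Sum>i\<in>UNIV. h $ i *\<^sub>R partial i (partials js f) (y + t *\<^sub>R h)))) (at t within {0..1})"
      unfolding Df_def
      by (rule has_vector_derivative_sum,
          rule bounded_linear.has_vector_derivative[OF bounded_linear_scaleR_right],
          rule has_vector_derivative_along_line, rule schwartz_partials_differentiable[OF f])
    also have "(\<Sum>js | length js = j. list_monomial js h *\<^sub>R
        (\<Sum>i\<in>UNIV. h $ i *\<^sub>R partial i (partials js f) (y + t *\<^sub>R h))) = Df (Suc j) t"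
      by (simp add: Df_def sum_lists_Suc scaleR_sum_right mult.commute)
    finally show ?thesis .
  qed
  \<comment> \<open>The bound is applied to an arbitrary list of length m, just to see that a norm
    lies below \<open>B\<close>.\<close>
  have "0 \<le> B"
    by (rule order_trans[OF norm_ge_zero B[of "replicate m undefined" 0]]) simp_all
  have int: "((\<lambda>x. ((1 - x) ^ (m - 1) / fact (m - 1)) *\<^sub>R Df m x) has_integral
      f (y + h) - P) {0..1}"
    using Taylor_has_integral[of m Df "Df 0" 0 1, OF \<open>m > 0\<close> refl deriv]
    by (simp add: P_def Df_def)
  have "norm (f (y + h) - P) \<le> M * measure lborel (cbox 0 (1 :: real))"
  proof (rule has_integral_bound[OF _ int[folded cbox_interval]])
    show "0 \<le> M"
      using \<open>0 \<le> B\<close> by (simp add: M_def)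
    fix t :: real assume "t \<in> cbox 0 1"
    then have t: "0 \<le> t" "t \<le> 1"
      by auto
    have "norm (Df m t) \<le> (\<Sum>js :: 'n list | length js = m. norm h ^ m * B)"
      unfolding Df_def
    proof (rule sum_norm_le)
      fix js :: "'n list" assume "js \<in> {js. length js = m}"
      then show "norm (list_monomial js h *\<^sub>R partials js f (y + t *\<^sub>R h)) \<le> norm h ^ m * B"
        using abs_list_monomial_le[of js h] B[of js t] t by (auto intro!: mult_mono)
    qed
    then have "norm (Df m t) \<le> M"
      by (simp add: M_def)
    moreover have "(1 - t) ^ (m - 1) / fact (m - 1) \<le> 1"
      using t by (simp add: divide_le_eq power_le_one order_trans[OF _ fact_ge_1])
    ultimately have "(1 - t) ^ (m - 1) / fact (m - 1) * norm (Df m t) \<le> 1 * M"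
      using t by (intro mult_mono) auto
    then show "norm (((1 - t) ^ (m - 1) / fact (m - 1)) *\<^sub>R Df m t) \<le> M"
      using t by simp
  qed
  then show ?thesis
    by (simp add: M_def P_def Df_def)
qed

lemma borel_measurable_cnj [measurable]: "cnj \<in> borel_measurable borel"
  by (intro borel_measurable_continuous_onI continuous_intros)

text \<open>The Taylor polynomial of f at y of degree below m pairs to zero with g, so it can be
  subtracted for free. The remainder is of size \<open>norm (\<epsilon> *\<^sub>R u) ^ m\<close>
  times the m-th derivatives on the segment; the decay of g absorbs the growth in u.\<close>

lemma moment_zero_imp_pairing_bound:
  fixes f g :: "real ^ 'n::finite \<Rightarrow> complex"
  assumes f: "f \<in> schwartz" and g: "g \<in> schwartz" and "m > 0"
    and moments: "\<And>js. (LINT u|lborel. of_real (list_monomial js u) * g u) = 0"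
  obtains C where "C \<ge> 0" "\<And>\<epsilon> y. 0 < \<epsilon> \<Longrightarrow> \<epsilon> \<le> 1 \<Longrightarrow>
    norm (pairing (\<lambda>u. f (y + \<epsilon> *\<^sub>R u)) g) \<le> C * \<epsilon> ^ m / (1 + norm y) ^ N"
proof -
  have [measurable]: "f \<in> borel_measurable borel" "g \<in> borel_measurable borel"
    by (simp_all add: schwartz_borel_measurable f g)
  obtain C0 where C0: "\<And>x. norm (f x) \<le> C0"
    using schwartz_decay[OF f, where N = 0 and js = "[]"] by auto
  obtain C1 where "C1 > 0" and
    C1: "\<And>js x. length js = m \<Longrightarrow> norm (partials js f x) \<le> C1 / (1 + norm x) ^ N"
    using schwartz_decay_uniform[OF f] by metis
  define \<kappa> where "\<kappa> = real (card {js :: 'n list. length js = m})"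
  \<comment> \<open>Of the weight, m powers come from the Taylor remainder and N from transferring
    the decay along the segment to its start y.\<close>
  define G where "G = (LINT u|lborel. (1 + norm u) ^ (m + N) * norm (g u))"
  have "G \<ge> 0"
    unfolding G_def by (intro Bochner_Integration.integral_nonneg) simp
  show ?thesis
  proof
    show "\<kappa> * C1 * G \<ge> 0"
      using \<open>C1 > 0\<close> \<open>G \<ge> 0\<close> by (simp add: \<kappa>_def)
    fix \<epsilon> :: real and y :: "real ^ 'n"
    assume \<epsilon>: "0 < \<epsilon>" "\<epsilon> \<le> 1"
    define P where "P = (\<lambda>u. \<Sum>j<m. (1 / fact j) *\<^sub>R
      (\<Sum>js | length js = j. list_monomial js (\<epsilon> *\<^sub>R u) *\<^sub>R partials js f y))"
    \<comment> \<open>Homogeneity extracts \<open>\<epsilon> ^ j\<close>; what remains is a finite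
      combination of conjugated moment integrands of g, each with integral 0.\<close>
    have P: "P u * cnj (g u) = (\<Sum>j<m. \<Sum>js | length js = j.
        (\<epsilon> ^ j / fact j) *\<^sub>R partials js f y * cnj (of_real (list_monomial js u) * g u))" for u
      unfolding P_def scaleR_sum_right sum_distrib_right
      by (intro sum.cong refl) (simp only: list_monomial_scale, simp add: scaleR_conv_of_real mult_ac)
    have mono_int: "integrable lborel (\<lambda>u. of_real (list_monomial js u) * g u)" for js
      by (rule schwartz_mult_integrable[OF g, where K = 1 and N = "length js"])
        (simp_all add: abs_list_monomial_le')
    have "has_bochner_integral lborel (\<lambda>u. c * cnj (of_real (list_monomial js u) * g u)) 0" for c js
      using mono_int[of js] moments[of js]
      by (simp add: has_bochner_integral_iff del: complex_cnj_mult)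
    then have "has_bochner_integral lborel (\<lambda>u. P u * cnj (g u))
        (\<Sum>j<m. \<Sum>js :: 'n list | length js = j. 0)"
      unfolding P by (intro has_bochner_integral_sum)
    then have P_int: "integrable lborel (\<lambda>u. P u * cnj (g u))"
      and P_zero: "(LINT u|lborel. P u * cnj (g u)) = 0"
      by (simp_all add: has_bochner_integral_iff)
    \<comment> \<open>\<open>schwartz_mult_integrable\<close> expects the factor \<open>g u\<close>
      itself, so the conjugate of the integrand is treated first.\<close>
    have "integrable lborel (\<lambda>u. cnj (f (y + \<epsilon> *\<^sub>R u)) * g u)"
      by (rule schwartz_mult_integrable[OF g, where K = C0 and N = 0]) (simp_all add: C0)
    then have "integrable lborel (\<lambda>u. cnj (cnj (f (y + \<epsilon> *\<^sub>R u)) * g u))"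
      by (rule integrable_cnj)
    then have f_int: "integrable lborel (\<lambda>u. f (y + \<epsilon> *\<^sub>R u) * cnj (g u))"
      by simp
    have diff_int: "integrable lborel (\<lambda>u. (f (y + \<epsilon> *\<^sub>R u) - P u) * cnj (g u))"
      using Bochner_Integration.integrable_diff[OF f_int P_int] by (simp add: left_diff_distrib)
    define A where "A = \<kappa> * C1 * \<epsilon> ^ m / (1 + norm y) ^ N"
    have "A \<ge> 0"
      using \<open>C1 > 0\<close> \<epsilon> by (simp add: A_def \<kappa>_def)
    have pointwise: "norm (f (y + \<epsilon> *\<^sub>R u) - P u) \<le> A * (1 + norm u) ^ (m + N)" for u
    proof -
      \<comment> \<open>For z on the segment,
        \<open>1 + norm y \<le> (1 + norm z) * (1 + norm u)\<close>, since z differs from y by at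
        most \<open>norm u\<close>. This moves the decay from z to y at the price of N powers of
        \<open>1 + norm u\<close>.\<close>
      define B where "B = C1 * (1 + norm u) ^ N / (1 + norm y) ^ N"
      have "B \<ge> 0"
        using \<open>C1 > 0\<close> by (simp add: B_def)
      have "norm (f (y + \<epsilon> *\<^sub>R u) - P u) \<le> \<kappa> * (norm (\<epsilon> *\<^sub>R u) ^ m * B)"
        unfolding P_def \<kappa>_def
      proof (rule schwartz_taylor_bound[OF f \<open>m > 0\<close>])
        fix js :: "'n list" and t :: real
        assume js: "length js = m" and t: "0 \<le> t" "t \<le> 1"
        define z where "z = y + t *\<^sub>R \<epsilon> *\<^sub>R u"
        have "norm y \<le> norm z + norm (t *\<^sub>R \<epsilon> *\<^sub>R u)"
          unfolding z_def using norm_triangle_ineq4[of "y + t *\<^sub>R \<epsilon> *\<^sub>R u" "t *\<^sub>R \<epsilon> *\<^sub>R u"] by simp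
        also have "norm (t *\<^sub>R \<epsilon> *\<^sub>R u) \<le> norm u"
          using t \<epsilon> mult_mono[of t 1 \<epsilon> 1] by (simp add: abs_mult mult.assoc[symmetric] mult_left_le_one_le)
        finally have "1 + norm y \<le> 1 + norm z + norm u + norm z * norm u"
          by (smt (verit) mult_nonneg_nonneg norm_ge_zero)
        also have "\<dots> = (1 + norm z) * (1 + norm u)"
          by (simp add: algebra_simps)
        finally have "1 + norm y \<le> (1 + norm z) * (1 + norm u)" .
        then have "(1 + norm y) ^ N \<le> ((1 + norm z) * (1 + norm u)) ^ N"
          by (intro power_mono) auto
        moreover have "0 < (1 + norm x) ^ N" for x :: "real ^ 'n"
          by (simp add: add_pos_nonneg)
        ultimately have "1 / (1 + norm z) ^ N \<le> (1 + norm u) ^ N / (1 + norm y) ^ N"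
          by (simp add: power_mult_distrib frac_le_eq pos_divide_le_eq pos_le_divide_eq mult.commute)
        from mult_left_mono[OF this, of C1] have "C1 * (1 / (1 + norm z) ^ N) \<le> B"
          using \<open>C1 > 0\<close> by (simp add: B_def)
        then show "norm (partials js f (y + t *\<^sub>R \<epsilon> *\<^sub>R u)) \<le> B"
          using C1[OF js, of z] by (simp add: z_def)
      qed
      also have "\<dots> = \<kappa> * \<epsilon> ^ m * B * norm u ^ m"
        using \<epsilon> by (simp add: power_mult_distrib)
      also have "\<dots> \<le> \<kappa> * \<epsilon> ^ m * B * (1 + norm u) ^ m"
        using \<open>B \<ge> 0\<close> \<epsilon> by (intro mult_left_mono power_mono) (auto simp: \<kappa>_def)
      also have "\<dots> = A * (1 + norm u) ^ (m + N)"
        by (simp add: A_def B_def power_add)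
      finally show ?thesis .
    qed
    have "pairing (\<lambda>u. f (y + \<epsilon> *\<^sub>R u)) g = (LINT u|lborel. (f (y + \<epsilon> *\<^sub>R u) - P u) * cnj (g u))"
      using Bochner_Integration.integral_diff[OF f_int P_int] P_zero
      by (simp add: pairing_def left_diff_distrib)
    also have "norm \<dots> \<le> (LINT u|lborel. A * ((1 + norm u) ^ (m + N) * norm (g u)))"
    proof (rule Bochner_Integration.integral_norm_bound_integral[OF diff_int])
      show "integrable lborel (\<lambda>u. A * ((1 + norm u) ^ (m + N) * norm (g u)))"
        by (intro integrable_mult_right schwartz_weighted_integrable g)
      fix u
      show "norm ((f (y + \<epsilon> *\<^sub>R u) - P u) * cnj (g u)) \<le> A * ((1 + norm u) ^ (m + N) * norm (g u))"
        using mult_right_mono[OF pointwise[of u], of "norm (g u)"] by (simp add: norm_mult mult.assoc)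
    qed
    also have "\<dots> = \<kappa> * C1 * G * \<epsilon> ^ m / (1 + norm y) ^ N"
      by (simp add: G_def A_def)
    finally show "norm (pairing (\<lambda>u. f (y + \<epsilon> *\<^sub>R u)) g) \<le> \<kappa> * C1 * G * \<epsilon> ^ m / (1 + norm y) ^ N" .
  qed
qed

section \<open>Decay of the pairings in the scale and the position of the cube\<close>

lemma integral_lborel_affine:
  fixes F :: "'a::euclidean_space \<Rightarrow> complex"
  assumes [measurable]: "F \<in> borel_measurable borel" and "c > 0"
  shows "(LINT x|lborel. F x) = c ^ DIM('a) *\<^sub>R (LINT u|lborel. F (t + c *\<^sub>R u))"
proof -
  have "(LINT x|lborel. F x) = (LINT x|density (distr lborel borel (\<lambda>x. t + c *\<^sub>R x)) (\<lambda>_. ennreal (c ^ DIM('a))). F x)"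
    using lborel_affine[of c t] \<open>c > 0\<close> by simp
  also have "\<dots> = c ^ DIM('a) *\<^sub>R (LINT u|lborel. F (t + c *\<^sub>R u))"
    using \<open>c > 0\<close> by (subst integral_density) (auto simp: integral_distr)
  finally show ?thesis .
qed

text \<open>The substitution x = \<epsilon> (y + u) with \<epsilon> = 2^(-l) moves the dilation from
  \<psi> to \<phi>, and conjugation then exchanges the two slots. The normalisation times the
  Jacobian is 2^(nl/2) 2^(-nl), hence at most 1.\<close>

lemma pairing_dilate_nonneg:
  fixes \<psi> \<phi> :: "real ^ 'n::finite \<Rightarrow> complex"
  assumes "\<psi> \<in> schwartz" "\<phi> \<in> schwartz"
  shows "norm (pairing (dilate \<psi> (int l, k)) \<phi>)
    \<le> norm (pairing (\<lambda>u. \<phi> ((1 / 2) ^ l *\<^sub>R (\<chi> i. of_int (k $ i)) + (1 / 2) ^ l *\<^sub>R u)) \<psi>)"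
proof -
  define \<epsilon> :: real where "\<epsilon> = (1 / 2) ^ l"
  define y :: "real ^ 'n" where "y = (\<chi> i. of_int (k $ i))"
  have measurable: "(\<lambda>x. \<psi> (2 ^ l *\<^sub>R x - y) * cnj (\<phi> x)) \<in> borel_measurable borel"
    by (intro borel_measurable_continuous_onI continuous_intros schwartz_continuous_on[OF assms(2)]
        continuous_on_compose2[OF schwartz_continuous_on[OF assms(1), of UNIV]]) auto
  define a where "a = 2 powr (real CARD('n) * real l / 2)"
  have "\<epsilon> > 0" and \<epsilon>2: "2 ^ l * \<epsilon> = 1"
    by (simp_all add: \<epsilon>_def power_mult_distrib[symmetric])
  have "pairing (dilate \<psi> (int l, k)) \<phi> = of_real a * (LINT x|lborel. \<psi> (2 ^ l *\<^sub>R x - y) * cnj (\<phi> x))"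
    by (simp add: pairing_def dilate_def a_def y_def mult.assoc)
  also have "(LINT x|lborel. \<psi> (2 ^ l *\<^sub>R x - y) * cnj (\<phi> x))
      = \<epsilon> ^ CARD('n) *\<^sub>R (LINT u|lborel. \<psi> (2 ^ l *\<^sub>R (\<epsilon> *\<^sub>R y + \<epsilon> *\<^sub>R u) - y) * cnj (\<phi> (\<epsilon> *\<^sub>R y + \<epsilon> *\<^sub>R u)))"
    by (subst integral_lborel_affine[OF _ \<open>\<epsilon> > 0\<close>, where t = "\<epsilon> *\<^sub>R y"]) (simp_all add: measurable)
  also have "(LINT u|lborel. \<psi> (2 ^ l *\<^sub>R (\<epsilon> *\<^sub>R y + \<epsilon> *\<^sub>R u) - y) * cnj (\<phi> (\<epsilon> *\<^sub>R y + \<epsilon> *\<^sub>R u)))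
      = (LINT u|lborel. cnj (\<phi> (\<epsilon> *\<^sub>R y + \<epsilon> *\<^sub>R u) * cnj (\<psi> u)))"
    using \<epsilon>2 by (simp add: scaleR_add_right mult.commute)
  also have "\<dots> = cnj (pairing (\<lambda>u. \<phi> (\<epsilon> *\<^sub>R y + \<epsilon> *\<^sub>R u)) \<psi>)"
    unfolding pairing_def by (rule Bochner_Integration.integral_cnj)
  finally have "norm (pairing (dilate \<psi> (int l, k)) \<phi>)
      = a * \<epsilon> ^ CARD('n) * norm (pairing (\<lambda>u. \<phi> (\<epsilon> *\<^sub>R y + \<epsilon> *\<^sub>R u)) \<psi>)"
    using \<open>\<epsilon> > 0\<close> by (simp add: norm_mult a_def)
  also have "a * \<epsilon> ^ CARD('n) \<le> 1"
  proof -
    have "a \<le> 2 powr (real (l * CARD('n)))"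
      unfolding a_def by (intro powr_mono) auto
    also have "\<dots> = (2 ^ l) ^ CARD('n)"
      by (subst powr_realpow) (auto simp: power_mult)
    finally have "a * \<epsilon> ^ CARD('n) \<le> (2 ^ l) ^ CARD('n) * \<epsilon> ^ CARD('n)"
      using \<open>\<epsilon> > 0\<close> by (intro mult_right_mono) auto
    then show ?thesis
      by (simp add: power_mult_distrib[symmetric] \<epsilon>2)
  qed
  then have "a * \<epsilon> ^ CARD('n) * norm (pairing (\<lambda>u. \<phi> (\<epsilon> *\<^sub>R y + \<epsilon> *\<^sub>R u)) \<psi>)
      \<le> 1 * norm (pairing (\<lambda>u. \<phi> (\<epsilon> *\<^sub>R y + \<epsilon> *\<^sub>R u)) \<psi>)"
    by (intro mult_right_mono) auto
  finally show ?thesis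
    by (simp add: \<epsilon>_def y_def)
qed

lemma pairing_dilate_nonpos:
  fixes \<psi> \<phi> :: "real ^ 'n::finite \<Rightarrow> complex"
  shows "norm (pairing (dilate \<psi> (- int l, k)) \<phi>)
    \<le> norm (pairing (\<lambda>x. \<psi> (- (\<chi> i. of_int (k $ i)) + (1 / 2) ^ l *\<^sub>R x)) \<phi>)"
proof -
  define a where "a = 2 powr (- (real CARD('n) * real l / 2))"
  have "a \<le> 2 powr 0"
    unfolding a_def by (intro powr_mono) auto
  have scale: "2 powi (- int l) = ((1 / 2) ^ l :: real)"
    by (simp add: power_int_minus power_one_over inverse_eq_divide)
  have "pairing (dilate \<psi> (- int l, k)) \<phi>
      = of_real a * pairing (\<lambda>x. \<psi> (- (\<chi> i. of_int (k $ i)) + (1 / 2) ^ l *\<^sub>R x)) \<phi>"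
    by (simp add: pairing_def dilate_def a_def mult.assoc scale)
  with \<open>a \<le> 2 powr 0\<close> show ?thesis
    by (simp add: norm_mult a_def mult_left_le_one_le)
qed

lemma pairing_dilate_bound:
  fixes \<psi> \<phi> :: "real ^ 'n::finite \<Rightarrow> complex"
  assumes \<psi>: "\<psi> \<in> schwartz" and \<phi>: "\<phi> \<in> schwartz"
    and \<psi>_moments: "\<And>js. (LINT u|lborel. of_real (list_monomial js u) * \<psi> u) = 0"
    and \<phi>_moments: "\<And>js. (LINT u|lborel. of_real (list_monomial js u) * \<phi> u) = 0"
  obtains C where "C \<ge> 0" "\<And>\<nu> k. norm (pairing (dilate \<psi> (\<nu>, k)) \<phi>)
    \<le> C * (1 / 2) ^ (M * nat \<bar>\<nu>\<bar>) / (1 + norm (\<chi> i. real_of_int (k $ i))) ^ N"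
proof -
  \<comment> \<open>For \<nu> \<ge> 0 the decay obtained is in
    \<open>norm (\<epsilon> *\<^sub>R y)\<close>, and \<open>\<epsilon> * (1 + norm y) \<le> 1 +
    norm (\<epsilon> *\<^sub>R y)\<close> converts it to decay in \<open>norm y\<close> at the cost
    of N powers of \<epsilon>. The successor makes m positive, as the pairing bound
    requires.\<close>
  define m where "m = Suc (M + N)"
  obtain C1 where "C1 \<ge> 0" and C1: "\<And>\<epsilon> y. 0 < \<epsilon> \<Longrightarrow> \<epsilon> \<le> 1 \<Longrightarrow>
      norm (pairing (\<lambda>u. \<phi> (y + \<epsilon> *\<^sub>R u)) \<psi>) \<le> C1 * \<epsilon> ^ m / (1 + norm y) ^ N"
    using moment_zero_imp_pairing_bound[OF \<phi> \<psi> _ \<psi>_moments] by (metis m_def zero_less_Suc)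
  obtain C2 where "C2 \<ge> 0" and C2: "\<And>\<epsilon> y. 0 < \<epsilon> \<Longrightarrow> \<epsilon> \<le> 1 \<Longrightarrow>
      norm (pairing (\<lambda>u. \<psi> (y + \<epsilon> *\<^sub>R u)) \<phi>) \<le> C2 * \<epsilon> ^ m / (1 + norm y) ^ N"
    using moment_zero_imp_pairing_bound[OF \<psi> \<phi> _ \<phi>_moments] by (metis m_def zero_less_Suc)
  show ?thesis
  proof
    show "C1 + C2 \<ge> 0"
      using \<open>C1 \<ge> 0\<close> \<open>C2 \<ge> 0\<close> by simp
    fix \<nu> :: int and k :: "int ^ 'n"
    define l where "l = nat \<bar>\<nu>\<bar>"
    define \<epsilon> :: real where "\<epsilon> = (1 / 2) ^ l"
    define y :: "real ^ 'n" where "y = (\<chi> i. of_int (k $ i))"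
    have \<epsilon>: "0 < \<epsilon>" "\<epsilon> \<le> 1"
      by (simp_all add: \<epsilon>_def power_le_one)
    have \<epsilon>M: "(1 / 2) ^ (M * nat \<bar>\<nu>\<bar>) = \<epsilon> ^ M"
      by (simp add: \<epsilon>_def l_def power_mult[symmetric] mult.commute)
    have pos: "0 < (1 + norm y) ^ N"
      by (simp add: add_pos_nonneg)
    have "norm (pairing (dilate \<psi> (\<nu>, k)) \<phi>) \<le> (C1 + C2) * \<epsilon> ^ M / (1 + norm y) ^ N"
    proof (cases "\<nu> \<ge> 0")
      case True
      then have "norm (pairing (dilate \<psi> (\<nu>, k)) \<phi>) \<le> norm (pairing (\<lambda>u. \<phi> (\<epsilon> *\<^sub>R y + \<epsilon> *\<^sub>R u)) \<psi>)"
        using pairing_dilate_nonneg[OF \<psi> \<phi>, of l k] by (simp add: \<epsilon>_def y_def l_def)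
      also have "\<dots> \<le> C1 * \<epsilon> ^ m / (1 + norm (\<epsilon> *\<^sub>R y)) ^ N"
        by (rule C1[OF \<epsilon>])
      also have "\<dots> \<le> C1 * \<epsilon> ^ m / (\<epsilon> * (1 + norm y)) ^ N"
        using \<open>C1 \<ge> 0\<close> \<epsilon> by (intro divide_left_mono power_mono mult_pos_pos zero_less_power)
          (auto simp: distrib_left add_pos_nonneg)
      also have "\<dots> = C1 * (\<epsilon> * \<epsilon> ^ M) / (1 + norm y) ^ N"
        using \<epsilon> by (simp add: m_def power_add power_mult_distrib)
      also have "\<dots> \<le> (C1 + C2) * \<epsilon> ^ M / (1 + norm y) ^ N"
        using pos \<epsilon> \<open>C1 \<ge> 0\<close> \<open>C2 \<ge> 0\<close> by (intro divide_right_mono mult_mono) (auto simp: mult_left_le_one_le)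
      finally show ?thesis .
    next
      case False
      then have "norm (pairing (dilate \<psi> (\<nu>, k)) \<phi>) \<le> norm (pairing (\<lambda>x. \<psi> (- y + \<epsilon> *\<^sub>R x)) \<phi>)"
        using pairing_dilate_nonpos[of \<psi> l k \<phi>] by (simp add: \<epsilon>_def y_def l_def)
      also have "\<dots> \<le> C2 * \<epsilon> ^ m / (1 + norm (- y)) ^ N"
        by (rule C2[OF \<epsilon>])
      also have "\<dots> \<le> (C1 + C2) * \<epsilon> ^ M / (1 + norm (- y)) ^ N"
        using pos \<epsilon> \<open>C1 \<ge> 0\<close> \<open>C2 \<ge> 0\<close>
        by (intro divide_right_mono mult_mono power_decreasing) (auto simp: m_def)
      finally show ?thesis
        by simp
    qed
    then show "norm (pairing (dilate \<psi> (\<nu>, k)) \<phi>)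
        \<le> (C1 + C2) * (1 / 2) ^ (M * nat \<bar>\<nu>\<bar>) / (1 + norm (\<chi> i. real_of_int (k $ i))) ^ N"
      unfolding \<epsilon>M y_def .
  qed
qed

section \<open>Mixed norms and the growth of the coefficients\<close>

lemma ennpow_mono: "0 \<le> r \<Longrightarrow> x \<le> y \<Longrightarrow> ennpow x r \<le> ennpow y r"
  by (cases x; cases y) (auto simp: ennpow_def powr_mono2 ennreal_leI top_unique)

lemma ennpow_ennreal: "0 \<le> x \<Longrightarrow> ennpow (ennreal x) r = ennreal (x powr r)"
  by (simp add: ennpow_def)

lemma ennpow_ennpow_inverse: "0 < r \<Longrightarrow> ennpow (ennpow x r) (1 / r) = x"
  by (cases x) (auto simp: ennpow_def powr_powr)

lemma iterated_norm_mono: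
  assumes "\<And>i. 0 < p $ i" and "\<And>x. f x \<le> g x"
  shows "iterated_norm p js f x \<le> iterated_norm p js g x"
  using assms(2)
proof (induction js arbitrary: f g)
  case (Cons i js)
  show ?case
    unfolding iterated_norm.simps
    using assms(1)[of i] by (intro Cons.IH ennpow_mono nn_integral_mono Cons.prems) auto
qed simp

text \<open>Integrating out the coordinate i drops its interval condition and multiplies the
  constant by \<open>b powr (1 / p $ i)\<close>, so the integrand keeps its shape and the induction
  runs over all c. Distinctness ensures that replacing the i-th coordinate leaves the remaining
  conditions alone.\<close>

lemma iterated_norm_box:
  fixes p :: "real ^ 'n::finite"
  assumes p: "\<And>i. 0 < p $ i" and "b \<ge> 0" and "distinct js" and "c \<ge> 0"
  shows "iterated_norm p js (\<lambda>x. if \<forall>j\<in>set js. x $ j \<in> {u j..<u j + b} then ennreal c else 0) z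
    = ennreal (c * (\<Prod>j\<in>set js. b powr (1 / p $ j)))"
  using \<open>distinct js\<close> \<open>c \<ge> 0\<close>
proof (induction js arbitrary: c)
  case (Cons i js)
  have inner: "ennpow (\<integral>\<^sup>+t. ennpow (if \<forall>j\<in>set (i # js). (\<chi> j. if j = i then t else x $ j) $ j \<in> {u j..<u j + b}
        then ennreal c else 0) (p $ i) \<partial>lborel) (1 / p $ i)
      = (if \<forall>j\<in>set js. x $ j \<in> {u j..<u j + b} then ennreal (c * b powr (1 / p $ i)) else 0)" for x
  proof (cases "\<forall>j\<in>set js. x $ j \<in> {u j..<u j + b}")
    case True
    have "(\<integral>\<^sup>+t. ennpow (if \<forall>j\<in>set (i # js). (\<chi> j. if j = i then t else x $ j) $ j \<in> {u j..<u j + b}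
        then ennreal c else 0) (p $ i) \<partial>lborel)
      = (\<integral>\<^sup>+t. ennreal (c powr p $ i) * indicator {u i..<u i + b} t \<partial>lborel)"
      using True Cons.prems p[of i]
      by (intro nn_integral_cong) (auto simp: ennpow_def indicator_def)
    also have "\<dots> = ennreal (c powr p $ i * b)"
      using \<open>b \<ge> 0\<close> by (simp add: nn_integral_cmult_indicator ennreal_mult)
    finally show ?thesis
      using True p[of i] Cons.prems \<open>b \<ge> 0\<close>
      by (simp add: ennpow_ennreal powr_mult powr_powr)
  next
    case False
    then have "ennpow (if \<forall>j\<in>set (i # js). (\<chi> j. if j = i then t else x $ j) $ j \<in> {u j..<u j + b}
        then ennreal c else 0) (p $ i) = 0" for t
      using Cons.prems by (auto simp: ennpow_def)
    then show ?thesis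
      using False by (auto simp: ennpow_def)
  qed
  have "iterated_norm p js (\<lambda>x. if \<forall>j\<in>set js. x $ j \<in> {u j..<u j + b}
      then ennreal (c * b powr (1 / p $ i)) else 0) z
    = ennreal (c * b powr (1 / p $ i) * (\<Prod>j\<in>set js. b powr (1 / p $ j)))"
    using Cons.prems by (intro Cons.IH) auto
  also have "c * b powr (1 / p $ i) * (\<Prod>j\<in>set js. b powr (1 / p $ j))
      = c * (\<Prod>j\<in>set (i # js). b powr (1 / p $ j))"
    using Cons.prems by (simp add: mult.assoc)
  finally show ?case
    unfolding iterated_norm.simps inner .
qed simp

lemma member_le_infsum_ennreal: "f a \<le> infsum f UNIV" for f :: "'a \<Rightarrow> ennreal"
proof -
  have "infsum f {a} \<le> infsum f UNIV"
    by (rule infsum_mono_neutral) (auto intro: nonneg_summable_on_complete)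
  then show ?thesis
    by simp
qed

lemma member_le_lq_norm:
  assumes "0 < q"
  shows "c \<nu> \<le> lq_norm q c"
proof (cases "q = \<infinity>")
  case False
  then have r: "0 < enn2real q"
    using assms by (simp add: enn2real_positive_iff less_top)
  have "c \<nu> = ennpow (ennpow (c \<nu>) (enn2real q)) (1 / enn2real q)"
    by (simp add: ennpow_ennpow_inverse r)
  also have "\<dots> \<le> ennpow (\<Sum>\<^sub>\<infinity>\<nu>. ennpow (c \<nu>) (enn2real q)) (1 / enn2real q)"
    using r by (intro ennpow_mono member_le_infsum_ennreal) auto
  finally show ?thesis
    using False by (simp add: lq_norm_def)
qed (simp add: lq_norm_def SUP_upper)

text \<open>By monotonicity the norm of a dominates that of the contribution of one cube, which is a
  constant on a box and has an explicit mixed norm. Solving for the coefficient gives the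
  bound.\<close>

lemma fdot_space_bound:
  fixes p :: "real ^ 'n::{finite,linorder}" and a :: "'n cube_seq"
  assumes a: "a \<in> fdot_space s p q" and p: "\<And>i. 0 < p $ i" and q: "0 < q"
  obtains A c where "A \<ge> 0" "\<And>\<nu> k. norm (a (\<nu>, k)) \<le> A * 2 powr (c * of_int \<nu>)"
proof
  define A where "A = enn2real (fdot_norm s p q a)"
  \<comment> \<open>The weight of the cube is 2^(\<nu> (s + n/2)) and the mixed norm of its
    indicator is 2^(-\<nu> \<Sum> 1/p_j); together they are 2^(-c\<nu>).\<close>
  define c where "c = (\<Sum>j\<in>UNIV. 1 / p $ j) - (s + real CARD('n) / 2)"
  show "A \<ge> 0"
    by (simp add: A_def)
  fix \<nu> and k :: "(int, 'n) vec"
  define w where "w = cube_volume TYPE('n) \<nu> powr (- s / real CARD('n) - 1/2)"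
  define b :: real where "b = 2 powr (- of_int \<nu>)"
  have w: "w = 2 powr (of_int \<nu> * (s + real CARD('n) / 2))"
  proof -
    have "- of_int \<nu> * real CARD('n) * (- s / real CARD('n) - 1 / 2) = of_int \<nu> * (s + real CARD('n) / 2)"
      by (simp add: field_simps)
    then show ?thesis
      by (simp only: w_def cube_volume_def powr_powr)
  qed
  have pow: "2 powi \<nu> = (2 powr of_int \<nu> :: real)"
    by (simp add: powr_real_of_int')
  have cube: "x \<in> dyadic_cube \<nu> k \<longleftrightarrow> (\<forall>j\<in>UNIV. x $ j \<in> {of_int (k $ j) * b..<of_int (k $ j) * b + b})" for x
    unfolding dyadic_cube_def pow b_def
    by (simp add: powr_minus field_simps)
  let ?f = "\<lambda>x :: (real, 'n) vec. if \<forall>j\<in>UNIV. x $ j \<in> {of_int (k $ j) * b..<of_int (k $ j) * b + b}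
      then ennreal (w * norm (a (\<nu>, k))) else 0"
  have "iterated_norm p (sorted_list_of_set UNIV) ?f 0
      = ennreal (w * norm (a (\<nu>, k)) * (\<Prod>j\<in>UNIV. b powr (1 / p $ j)))"
    using iterated_norm_box[OF p, of b "sorted_list_of_set UNIV" "w * norm (a (\<nu>, k))" "\<lambda>j. of_int (k $ j) * b" 0]
    by (simp add: b_def w_def)
  also have "(\<Prod>j\<in>UNIV. b powr (1 / p $ j)) = b powr (\<Sum>j\<in>UNIV. 1 / p $ j)"
    by (simp add: powr_sum b_def)
  also have "w * norm (a (\<nu>, k)) * b powr (\<Sum>j\<in>UNIV. 1 / p $ j) = norm (a (\<nu>, k)) * 2 powr (- c * of_int \<nu>)"
    by (simp add: w b_def c_def powr_powr powr_add[symmetric] algebra_simps)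
  finally have "ennreal (norm (a (\<nu>, k)) * 2 powr (- c * of_int \<nu>)) = iterated_norm p (sorted_list_of_set UNIV) ?f 0" ..
  also have "\<dots> \<le> fdot_norm s p q a"
    unfolding fdot_norm_def mixed_norm_def
  proof (rule iterated_norm_mono[OF p])
    fix x
    let ?g = "\<lambda>\<nu> k. ennreal (cube_volume TYPE('n) \<nu> powr (- s / real CARD('n) - 1/2) * norm (a (\<nu>, k))
       * indicator (dyadic_cube \<nu> k) x)"
    have "?f x = ?g \<nu> k"
      using cube[of x] by (auto simp: w_def indicator_def)
    also have "\<dots> \<le> (\<Sum>\<^sub>\<infinity>k. ?g \<nu> k)"
      by (rule member_le_infsum_ennreal)
    also have "\<dots> \<le> lq_norm q (\<lambda>\<nu>. \<Sum>\<^sub>\<infinity>k. ?g \<nu> k)"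
      by (rule member_le_lq_norm[OF q])
    finally show "?f x \<le> lq_norm q (\<lambda>\<nu>. \<Sum>\<^sub>\<infinity>k. ?g \<nu> k)" .
  qed
  \<comment> \<open>Membership in \<open>fdot_space\<close> makes the norm finite, so
    \<open>enn2real\<close> does not fall back to its value 0 at infinity.\<close>
  also have "\<dots> = ennreal A"
    using a by (simp add: A_def fdot_space_def less_top)
  finally have "norm (a (\<nu>, k)) * 2 powr (- c * of_int \<nu>) \<le> A"
    by (simp add: A_def)
  then show "norm (a (\<nu>, k)) \<le> A * 2 powr (c * of_int \<nu>)"
    by (simp add: powr_minus field_simps)
qed

section \<open>Summability over scales and lattice points\<close>

lemma summable_on_int_inverse_square: "(\<lambda>j :: int. 1 / (1 + \<bar>of_int j\<bar>)\<^sup>2 :: real) summable_on UNIV"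
proof -
  have "summable (\<lambda>n. 1 / (1 + real n)\<^sup>2)"
    using inverse_power_summable[of 2, where 'a = real] summable_Suc_iff[of "\<lambda>n. inverse ((real n)\<^sup>2)"]
    by (simp add: divide_inverse add.commute)
  then have nat: "(\<lambda>n. 1 / (1 + real n)\<^sup>2) summable_on UNIV"
    by (intro norm_summable_imp_summable_on) simp
  have "(\<lambda>j :: int. 1 / (1 + \<bar>of_int j\<bar>)\<^sup>2 :: real) summable_on range int"
    by (subst summable_on_reindex) (use nat in \<open>simp_all add: comp_def\<close>)
  moreover have "(\<lambda>j :: int. 1 / (1 + \<bar>of_int j\<bar>)\<^sup>2 :: real) summable_on range (\<lambda>n. - int n)"
    by (subst summable_on_reindex) (use nat in \<open>simp_all add: comp_def inj_on_def\<close>)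
  ultimately have "(\<lambda>j :: int. 1 / (1 + \<bar>of_int j\<bar>)\<^sup>2 :: real) summable_on range int \<union> range (\<lambda>n. - int n)"
    by (rule summable_on_union)
  moreover have "j \<in> range int \<union> range (\<lambda>n. - int n)" for j
    by (cases j rule: int_cases2) auto
  then have "range int \<union> range (\<lambda>n. - int n) = UNIV"
    by blast
  ultimately show ?thesis
    by simp
qed

text \<open>A finite set of vectors lies in a grid over a finite set \<open>J\<close>. The sum over
  the grid factors into one-dimensional sums, each bounded by the full sum of w, which bounds all
  finite partial sums.\<close>

lemma summable_on_prod_vec:
  fixes w :: "'a \<Rightarrow> real"
  assumes w: "w summable_on UNIV" and nonneg: "\<And>j. 0 \<le> w j"
  shows "(\<lambda>k :: 'a ^ 'n::finite. \<Prod>i\<in>UNIV. w (k $ i)) summable_on UNIV"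
proof (rule nonneg_bdd_above_summable_on)
  show "bdd_above (sum (\<lambda>k :: 'a ^ 'n. \<Prod>i\<in>UNIV. w (k $ i)) ` {F. F \<subseteq> UNIV \<and> finite F})"
  proof (rule bdd_aboveI2)
    fix F :: "('a ^ 'n) set" assume "F \<in> {F. F \<subseteq> UNIV \<and> finite F}"
    then have "finite F"
      by simp
    define J where "J = (\<Union>i. (\<lambda>k. k $ i) ` F)"
    have "finite J"
      using \<open>finite F\<close> by (simp add: J_def)
    have "(\<Sum>k\<in>F. \<Prod>i\<in>UNIV. w (k $ i)) = (\<Sum>g\<in>vec_nth ` F. \<Prod>i\<in>UNIV. w (g i))"
      by (subst sum.reindex) (simp_all add: inj_on_def vec_nth_inject)
    also have "\<dots> \<le> (\<Sum>g\<in>PiE (UNIV :: 'n set) (\<lambda>_. J). \<Prod>i\<in>UNIV. w (g i))"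
    proof (rule sum_mono2)
      show "finite (PiE (UNIV :: 'n set) (\<lambda>_. J))"
        using \<open>finite J\<close> by (intro finite_PiE) auto
      show "vec_nth ` F \<subseteq> PiE UNIV (\<lambda>_. J)"
        by (auto simp: J_def)
    qed (simp add: prod_nonneg nonneg)
    also have "\<dots> = (\<Prod>i\<in>(UNIV :: 'n set). \<Sum>j\<in>J. w j)"
      using \<open>finite J\<close> by (subst prod_sum_PiE) auto
    also have "\<dots> \<le> (\<Prod>i\<in>(UNIV :: 'n set). infsum w UNIV)"
      by (intro prod_mono conjI sum_nonneg finite_sum_le_infsum) (use \<open>finite J\<close> w nonneg in auto)
    finally show "(\<Sum>k\<in>F. \<Prod>i\<in>UNIV. w (k $ i)) \<le> (\<Prod>i\<in>(UNIV :: 'n set). infsum w UNIV)" .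
  qed
qed (simp add: prod_nonneg nonneg)

text \<open>Discrete counterpart of \<open>integrable_inverse_one_plus_norm_power\<close>: the
  exponent 2n is again split into one square per coordinate.\<close>

lemma summable_on_int_vec:
  "(\<lambda>k :: int ^ 'n::finite. 1 / (1 + norm (\<chi> i. real_of_int (k $ i))) ^ (2 * CARD('n))) summable_on UNIV"
proof (rule summable_on_comparison_test)
  show "(\<lambda>k :: int ^ 'n. \<Prod>i\<in>UNIV. 1 / (1 + \<bar>real_of_int (k $ i)\<bar>)\<^sup>2) summable_on UNIV"
    by (rule summable_on_prod_vec[OF summable_on_int_inverse_square]) simp
  fix k :: "int ^ 'n"
  let ?y = "\<chi> i. real_of_int (k $ i)"
  have "1 / (1 + norm ?y) ^ (2 * CARD('n)) = (\<Prod>i\<in>(UNIV :: 'n set). 1 / (1 + norm ?y)\<^sup>2)"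
    by (simp add: power_mult power_one_over)
  also have "\<dots> \<le> (\<Prod>i\<in>UNIV. 1 / (1 + \<bar>real_of_int (k $ i)\<bar>)\<^sup>2)"
  proof (intro prod_mono conjI divide_left_mono power_mono)
    show "1 + \<bar>real_of_int (k $ i)\<bar> \<le> 1 + norm ?y" for i
      using component_le_norm_cart[of ?y i] by simp
  qed (auto intro!: mult_pos_pos zero_less_power add_pos_nonneg)
  finally show "1 / (1 + norm ?y) ^ (2 * CARD('n)) \<le> (\<Prod>i\<in>UNIV. 1 / (1 + \<bar>real_of_int (k $ i)\<bar>)\<^sup>2)" .
qed simp

lemma summable_on_product:
  fixes f :: "'a \<Rightarrow> real" and g :: "'b \<Rightarrow> real"
  assumes f: "f summable_on UNIV" "\<And>x. 0 \<le> f x" and g: "g summable_on UNIV" "\<And>y. 0 \<le> g y"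
  shows "(\<lambda>(x, y). f x * g y) summable_on UNIV"
proof -
  have "(\<lambda>(x, y). f x * g y) summable_on (SIGMA x:UNIV. UNIV)"
  proof (rule summable_on_SigmaI[where g = "\<lambda>x. f x * infsum g UNIV"])
    show "((\<lambda>y. case (x, y) of (x, y) \<Rightarrow> f x * g y) has_sum f x * infsum g UNIV) UNIV" for x
      using has_sum_cmult_right[OF has_sum_infsum[OF g(1)], of "f x"] by simp
    show "(\<lambda>x. f x * infsum g UNIV) summable_on UNIV"
      by (intro summable_on_cmult_left f)
  qed (simp add: f g)
  then show ?thesis
    by simp
qed

section \<open>Moments of \<phi> and \<psi>, and the final summation\<close>

lemma schwartz0_moment_zero:
  "\<phi> \<in> schwartz0 \<Longrightarrow> (LINT u|lborel. of_real (list_monomial js u) * \<phi> u) = 0"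
  by (simp add: schwartz0_def list_monomial_eq_monomial)

text \<open>Since \<open>K0\<close> is positive, the support condition leaves a ball around the
  origin on which the Fourier transform vanishes. The general result at frequency 0, where the
  exponential is 1, yields the moments.\<close>

lemma admissible_moment_zero:
  fixes \<psi> :: "real ^ 'n::finite \<Rightarrow> complex"
  assumes "admissible K0 K1 K1' K0' \<psi>" "0 < K0"
  shows "(LINT u|lborel. of_real (list_monomial js u) * \<psi> u) = 0"
proof -
  have "fourier \<psi> \<xi> = 0" if "norm \<xi> < K0" for \<xi>
  proof (rule ccontr)
    assume "fourier \<psi> \<xi> \<noteq> 0"
    then have "\<xi> \<in> closure {\<xi>. fourier \<psi> \<xi> \<noteq> 0}"
      by (intro subsetD[OF closure_subset]) simp
    moreover have "closure {\<xi>. fourier \<psi> \<xi> \<noteq> 0} \<subseteq> {\<xi>. K0 \<le> norm \<xi> \<and> norm \<xi> \<le> K0'}"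
      using assms(1) unfolding admissible_def by (elim conjE)
    ultimately have "K0 \<le> norm \<xi>"
      by blast
    with that show False
      by simp
  qed
  moreover have "\<psi> \<in> schwartz"
    using assms(1) by (simp add: admissible_def)
  ultimately show ?thesis
    using fourier_zero_imp_moment_zero[of \<psi> K0 0 js] assms(2) by simp
qed

text \<open>The first \<lceil>|c|\<rceil> powers of 2^(-|\<nu>|) absorb the growth of 2^(c\<nu>) for
  either sign of c\<nu>. The other two leave 2^(-2|\<nu>|), which is summable by comparison through
  1 + l \<le> 2^l.\<close>

lemma powr_half_power_le:
  fixes c :: real and \<nu> :: int
  shows "2 powr (c * of_int \<nu>) * (1 / 2) ^ ((nat \<lceil>\<bar>c\<bar>\<rceil> + 2) * nat \<bar>\<nu>\<bar>) \<le> 1 / (1 + \<bar>of_int \<nu>\<bar>)\<^sup>2"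
proof -
  define L where "L = nat \<lceil>\<bar>c\<bar>\<rceil>"
  define l where "l = nat \<bar>\<nu>\<bar>"
  have l: "\<bar>of_int \<nu>\<bar> = real l"
    by (simp add: l_def)
  have "c * of_int \<nu> \<le> \<bar>c\<bar> * real l"
    using abs_ge_self[of "c * of_int \<nu>"] by (simp add: abs_mult l)
  also have "\<dots> \<le> real L * real l"
    by (intro mult_right_mono) (auto simp: L_def real_nat_ceiling_ge)
  finally have "2 powr (c * of_int \<nu>) \<le> 2 powr real (L * l)"
    by (intro powr_mono) auto
  then have "2 powr (c * of_int \<nu>) * (1 / 2) ^ ((L + 2) * l) \<le> 2 ^ (L * l) * (1 / 2) ^ ((L + 2) * l)"
    by (intro mult_right_mono) (simp_all only: powr_realpow zero_less_numeral, simp)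
  also have "\<dots> = 1 / (2 ^ l)\<^sup>2"
    by (simp add: power_add power_mult[symmetric] distrib_right power_one_over power2_eq_square mult_2_right)
  also have "\<dots> \<le> 1 / (1 + real l)\<^sup>2"
  proof (intro divide_left_mono power_mono mult_pos_pos)
    have "Suc l \<le> 2 ^ l"
      using less_exp[of l] by (rule Suc_leI)
    then have "real (Suc l) \<le> real (2 ^ l)"
      by (simp only: of_nat_le_iff)
    then show "1 + real l \<le> 2 ^ l"
      by simp
  qed auto
  finally show ?thesis
    by (simp only: L_def l_def[symmetric] l)
qed

theorem proposition5p2:
  fixes K0 K1 K1' K0' s :: real
    and \<psi> :: "real ^ 'n::{finite,linorder} \<Rightarrow> complex"
    and p :: "real ^ 'n::{finite,linorder}"
    and q :: ennreal
  assumes "0 < K0" "K0 < K1" "K1 < 1" "1 < K1'" "K1' < K0'"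
    and "2 * K1 < K1'" "K0' < pi"
    and "admissible K0 K1 K1' K0' \<psi>"
    and "\<And>i. 0 < p $ i"
    and "0 < q"
  shows "fdot_space s p q \<subseteq> synthesis_domain \<psi>"
proof
  fix a assume "a \<in> fdot_space s p q"
  then obtain A c where "A \<ge> 0" and a: "\<And>\<nu> k. norm (a (\<nu>, k)) \<le> A * 2 powr (c * of_int \<nu>)"
    using fdot_space_bound assms(9,10) by blast
  have \<psi>: "\<psi> \<in> schwartz"
    using assms(8) by (simp add: admissible_def)
  define W where "W = (\<lambda>k :: (int, 'n) vec. 1 / (1 + norm (\<chi> i. real_of_int (k $ i))) ^ (2 * CARD('n)))"
  show "a \<in> synthesis_domain \<psi>"
    unfolding synthesis_domain_def
  proof (intro CollectI ballI)
    fix \<phi> :: "(real, 'n) vec \<Rightarrow> complex" assume \<phi>0: "\<phi> \<in> schwartz0"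
    then have \<phi>: "\<phi> \<in> schwartz"
      by (simp add: schwartz0_def)
    \<comment> \<open>The decay in the scale is chosen after the growth exponent c of the
      coefficients, and the decay in k is the power 2n for which \<open>summable_on_int_vec\<close>
      gives convergence.\<close>
    obtain C where "C \<ge> 0" and C: "\<And>\<nu> k. norm (pairing (dilate \<psi> (\<nu>, k)) \<phi>)
        \<le> C * (1 / 2) ^ ((nat \<lceil>\<bar>c\<bar>\<rceil> + 2) * nat \<bar>\<nu>\<bar>) / (1 + norm (\<chi> i. real_of_int (k $ i))) ^ (2 * CARD('n))"
      using pairing_dilate_bound[OF \<psi> \<phi> admissible_moment_zero[OF assms(8,1)] schwartz0_moment_zero[OF \<phi>0]]
      by blast
    show "(\<lambda>Q. norm (a Q) * norm (pairing (dilate \<psi> Q) \<phi>)) summable_on UNIV"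
    proof (rule summable_on_comparison_test)
      \<comment> \<open>The majorant separates scale and position, so the double sum is a product of
        two convergent sums.\<close>
      show "(\<lambda>Q. A * C * (case Q of (\<nu>, k) \<Rightarrow> 1 / (1 + \<bar>of_int \<nu>\<bar>)\<^sup>2 * W k)) summable_on UNIV"
        unfolding W_def
        by (intro summable_on_cmult_right summable_on_product summable_on_int_inverse_square summable_on_int_vec)
          simp_all
      fix Q :: "int \<times> (int, 'n) vec"
      obtain \<nu> k where Q: "Q = (\<nu>, k)"
        by force
      have "W k \<ge> 0"
        by (simp add: W_def)
      have "norm (a Q) * norm (pairing (dilate \<psi> Q) \<phi>)
          \<le> (A * 2 powr (c * of_int \<nu>)) * (C * (1 / 2) ^ ((nat \<lceil>\<bar>c\<bar>\<rceil> + 2) * nat \<bar>\<nu>\<bar>) * W k)"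
        using a[of \<nu> k] C[of \<nu> k] \<open>A \<ge> 0\<close> unfolding Q W_def by (intro mult_mono) auto
      also have "\<dots> = A * C * ((2 powr (c * of_int \<nu>) * (1 / 2) ^ ((nat \<lceil>\<bar>c\<bar>\<rceil> + 2) * nat \<bar>\<nu>\<bar>)) * W k)"
        by (simp only: mult_ac)
      also have "\<dots> \<le> A * C * (1 / (1 + \<bar>of_int \<nu>\<bar>)\<^sup>2 * W k)"
        using \<open>A \<ge> 0\<close> \<open>C \<ge> 0\<close> \<open>W k \<ge> 0\<close> by (intro mult_left_mono mult_right_mono powr_half_power_le) auto
      finally show "norm (a Q) * norm (pairing (dilate \<psi> Q) \<phi>)
          \<le> A * C * (case Q of (\<nu>, k) \<Rightarrow> 1 / (1 + \<bar>of_int \<nu>\<bar>)\<^sup>2 * W k)"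
        by (simp only: Q prod.case)
    qed simp
  qed
qed

end
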